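(* For every line joining nodes $i$ and $j$ of the network, in the direction $i\to j$, and for every $\mathbf x\in\mathcal K$, the SOCP line vulnerability index and the line vulnerability index satisfy $$\alpha^{\rm SOCP}_{i\to j}(\mathbf x)\le\alpha_{i\to j}.$$
   Context: **Network and measurements.** $\mathcal G=(\mathcal N,\mathcal L)$ is a finite simple graph with $n_b$ buses and $n_l$ lines. Each line $\ell$ has a fixed orientation $\ell=(i,j)$ and real parameters $g_\ell,b_\ell,b^{\rm sh}_\ell$. The variable vector $\mathbf x\in\mathbb R^{n_x}$, $n_x=n_b+2n_l$, has coordinates $x^{\rm mg}_k$ ($k\in\mathcal N$) and $x^{\rm re}_\ell,x^{\rm im}_\ell$ ($\ell\in\mathcal L$). Each row of the sensing matrix $\mathbf A\in\mathbb R^{n_m\times n_x}$ is a positive multiple, normalized to Euclidean norm $1$, of one of the following linear forms (any subset of which may be measured): - voltage magnitude at node $k$: $x^{\rm mg}_k$; - branch flows on $\ell=(i,j)$: at end $i$, $p_{ij}=g_\ell x^{\rm mg}_i-g_\ell x^{\rm re}_\ell-b_\ell x^{\rm im}_\ell$ and $q_{ij}=-(b_\ell+\tfrac12 b^{\rm sh}_\ell)x^{\rm mg}_i+b_\ell x^{\rm re}_\ell-g_\ell x^{\rm im}_\ell$; at end $j$, $p_{ji}=g_\ell x^{\rm mg}_j-g_\ell x^{\rm re}_\ell+b_\ell x^{\rm im}_\ell$ and $q_{ji}=-(b_\ell+\tfrac12 b^{\rm sh}_\ell)x^{\rm mg}_j+b_\ell x^{\rm re}_\ell+g_\ell x^{\rm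 im}_\ell$; - nodal injections at $k$: $p_k$ (resp. $q_k$), the sum of the flows $p_{kj}$ (resp. $q_{kj}$) over all lines incident to $k$. A measurement "depends on" the variables appearing in its formula. $\mathbf A_{\mathcal M,\mathcal X}$ denotes the submatrix with rows $\mathcal M$ and columns $\mathcal X$. **Second-order cone constraints.** $\mathcal K$ is the set of $\mathbf x\in\mathbb R^{n_x}$ such that for every line $\ell=(i,j)\in\mathcal L$ the Hermitian matrix $\begin{bmatrix}x^{\rm mg}_i & x^{\rm re}_\ell+\mathrm i x^{\rm im}_\ell\\ x^{\rm re}_\ell-\mathrm i x^{\rm im}_\ell & x^{\rm mg}_j\end{bmatrix}$ is positive semidefinite. Let $\mathbf c_\ell\in\mathbb R^{n_x}$ and $\mathbf D_\ell\in\mathbb R^{4\times n_x}$ be defined by $\mathbf c_\ell^\top\mathbf x=(x^{\rm mg}_i+x^{\rm mg}_j)/\sqrt2$ and $\mathbf D_\ell\mathbf x=(x^{\rm mg}_i/\sqrt2,\ x^{\rm mg}_j/\sqrt2,\ x^{\rm re}_\ell,\ x^{\rm im}_\ell)^\top$; put $\mathbf T_\ell=\mathbf c_\ell\mathbf c_\ell^\top-\mathbf D_\ell^\top\mathbf D_\ell$. **Local sets.** For a line $\ell_0$ joining $i,j$ and the direction $i\to j$: $\mathcal X_{i\to j}$ consists of $x^{\rm mg}_j$, of $x^{\rm mg}_k$ for all neighbours $k\ne i$ of $j$, and of $x^{\rm re}_\eta,x^{\rm im}_\eta$ for the lines $\eta$ joining $j$ to these $k$. $\mathcal L_{i\to j}$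 is the set consisting of $\ell_0$ and of these lines $\eta$. $\mathcal M^g_{i\to j}$ is the set of measurements depending only on $\mathcal X_{i\to j}$; $\mathcal M^b_{i\to j}$ is the set of measurements depending both on variables in $\mathcal X_{i\to j}$ and on $x^{\rm re}_{\ell_0},x^{\rm im}_{\ell_0}$. **Indices.** Write $\mathbf A_g=\mathbf A_{\mathcal M^g_{i\to j},\mathcal X_{i\to j}}$, $\mathbf A_b=\mathbf A_{\mathcal M^b_{i\to j},\mathcal X_{i\to j}}$. Then $$\alpha_{i\to j}=\max_{\boldsymbol\xi\in\{-1,1\}^{|\mathcal M^b_{i\to j}|}}\ \min_{\mathbf h}\{\|\mathbf h\|_\infty:\ \mathbf A_g^\top\mathbf h+\mathbf A_b^\top\boldsymbol\xi=\mathbf 0\},$$ $$\alpha^{\rm SOCP}_{i\to j}(\mathbf x)=\max_{\boldsymbol\xi\in\{-1,1\}^{|\mathcal M^b_{i\to j}|}}\ \min_{\mathbf h,\,\omega}\Big\{\|\mathbf h\|_\infty:\ \mathbf A_g^\top\mathbf h+\mathbf A_b^\top\boldsymbol\xi+\sum_{\ell\in\mathcal L_{i\to j}}\omega_\ell[\mathbf T_\ell\mathbf x]_{\mathcal X_{i\to j}}=\mathbf 0,\ \omega_\ell\ge0\Big\},$$ where $\mathbf h\in\mathbb R^{|\mathcal M^g_{i\to j}|}$, $[\cdot]_{\mathcal X_{i\to j}}$ is restriction to the coordinates in $\mathcal X_{i\to j}$, and a minimum over an empty set is $+\infty$. *)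

theory Defs
  imports "HOL-Analysis.Analysis"
begin

(* Buses and lines are finite index types; the orientation of a line l is (src l, dst l). *)
record ('n, 'l) network =
  src :: "'l \<Rightarrow> 'n"
  dst :: "'l \<Rightarrow> 'n"
  cond :: "'l \<Rightarrow> real"
  susc :: "'l \<Rightarrow> real"
  shunt :: "'l \<Rightarrow> real"

definition joins :: "('n, 'l) network \<Rightarrow> 'l \<Rightarrow> 'n \<Rightarrow> 'n \<Rightarrow> bool" where
  "joins net l i j \<longleftrightarrow>
     (src net l = i \<and> dst net l = j) \<or> (src net l = j \<and> dst net l = i)"

definition simple_network :: "('n, 'l) network \<Rightarrow> bool" where
  "simple_network net \<longleftrightarrow>
     (\<forall>l. src net l \<noteq> dst net l) \<and>
     (\<forall>l l'. {src net l, dst net l} = {src net l', dst net l'} \<longrightarrow> l = l')"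

(* Coordinates of the variable vector: x^mg at buses, x^re and x^im at lines. *)
datatype ('n, 'l) var = Mag 'n | ReL 'l | ImL 'l

instance var :: (finite, finite) finite
proof
  have "(UNIV :: ('a, 'b) var set) = range Mag \<union> range ReL \<union> range ImL"
    by (rule set_eqI, case_tac x) simp_all
  then show "finite (UNIV :: ('a, 'b) var set)"
    by (metis finite_UnI finite_class.finite_UNIV finite_imageI)
qed

(* PSrc l is p_ij and PDst l is p_ji for l = (i,j); PInj k is the injection p_k.
   Likewise for q. *)
datatype ('n, 'l) meas =
  VMag 'n | PSrc 'l | QSrc 'l | PDst 'l | QDst 'l | PInj 'n | QInj 'n

instance meas :: (finite, finite) finite
proof
  have "(UNIV :: ('a, 'b) meas set) = range VMag \<union> range PSrc \<union> range QSrc \<union>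
      range PDst \<union> range QDst \<union> range PInj \<union> range QInj"
    by (rule set_eqI, case_tac x) simp_all
  then show "finite (UNIV :: ('a, 'b) meas set)"
    by (metis finite_UnI finite_class.finite_UNIV finite_imageI)
qed

type_synonym ('n, 'l) state = "real ^ ('n, 'l) var"

abbreviation coord :: "('n::finite, 'l::finite) var \<Rightarrow> ('n, 'l) state" where
  "coord v \<equiv> axis v 1"

(* Coefficient vectors of the branch flows at the two ends of a line. *)
definition p_src :: "('n::finite, 'l::finite) network \<Rightarrow> 'l \<Rightarrow> ('n, 'l) state" where
  "p_src net l =
     cond net l *\<^sub>R coord (Mag (src net l)) - cond net l *\<^sub>R coord (ReL l)
     - susc net l *\<^sub>R coord (ImL l)"

definition q_src :: "('n::finite, 'l::finite) network \<Rightarrow> 'l \<Rightarrow> ('n, 'l) state" where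
  "q_src net l =
     - (susc net l + shunt net l / 2) *\<^sub>R coord (Mag (src net l))
     + susc net l *\<^sub>R coord (ReL l) - cond net l *\<^sub>R coord (ImL l)"

definition p_dst :: "('n::finite, 'l::finite) network \<Rightarrow> 'l \<Rightarrow> ('n, 'l) state" where
  "p_dst net l =
     cond net l *\<^sub>R coord (Mag (dst net l)) - cond net l *\<^sub>R coord (ReL l)
     + susc net l *\<^sub>R coord (ImL l)"

definition q_dst :: "('n::finite, 'l::finite) network \<Rightarrow> 'l \<Rightarrow> ('n, 'l) state" where
  "q_dst net l =
     - (susc net l + shunt net l / 2) *\<^sub>R coord (Mag (dst net l))
     + susc net l *\<^sub>R coord (ReL l) + cond net l *\<^sub>R coord (ImL l)"

primrec form :: "('n::finite, 'l::finite) network \<Rightarrow> ('n, 'l) meas \<Rightarrow> ('n, 'l) state" where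
  "form net (VMag k) = coord (Mag k)"
| "form net (PSrc l) = p_src net l"
| "form net (QSrc l) = q_src net l"
| "form net (PDst l) = p_dst net l"
| "form net (QDst l) = q_dst net l"
| "form net (PInj k) = (\<Sum>l | src net l = k. p_src net l) + (\<Sum>l | dst net l = k. p_dst net l)"
| "form net (QInj k) = (\<Sum>l | src net l = k. q_src net l) + (\<Sum>l | dst net l = k. q_dst net l)"

definition src_vars :: "('n, 'l) network \<Rightarrow> 'l \<Rightarrow> ('n, 'l) var set" where
  "src_vars net l = {Mag (src net l), ReL l, ImL l}"

definition dst_vars :: "('n, 'l) network \<Rightarrow> 'l \<Rightarrow> ('n, 'l) var set" where
  "dst_vars net l = {Mag (dst net l), ReL l, ImL l}"

definition inj_vars :: "('n, 'l) network \<Rightarrow> 'n \<Rightarrow> ('n, 'l) var set" where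
  "inj_vars net k =
     (\<Union>l\<in>{l. src net l = k}. src_vars net l) \<union> (\<Union>l\<in>{l. dst net l = k}. dst_vars net l)"

(* The variables appearing in the formula of a measurement.  This is read off the formula, so
   a variable whose coefficient happens to vanish still counts. *)
primrec meas_vars :: "('n, 'l) network \<Rightarrow> ('n, 'l) meas \<Rightarrow> ('n, 'l) var set" where
  "meas_vars net (VMag k) = {Mag k}"
| "meas_vars net (PSrc l) = src_vars net l"
| "meas_vars net (QSrc l) = src_vars net l"
| "meas_vars net (PDst l) = dst_vars net l"
| "meas_vars net (QDst l) = dst_vars net l"
| "meas_vars net (PInj k) = inj_vars net k"
| "meas_vars net (QInj k) = inj_vars net k"

(* Only the rows in the set M of measured quantities are rows of the sensing matrix; the others
   are zero padding.  Unit norm of the rows entails that no measured form is identically zero. *)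
definition sensing_matrix ::
  "('n::finite, 'l::finite) network \<Rightarrow> ('n, 'l) meas set \<Rightarrow>
   real ^ ('n, 'l) var ^ ('n, 'l) meas \<Rightarrow> bool" where
  "sensing_matrix net M A \<longleftrightarrow>
     (\<forall>m\<in>M. norm (A $ m) = 1 \<and> (\<exists>c>0. A $ m = c *\<^sub>R form net m)) \<and>
     (\<forall>m. m \<notin> M \<longrightarrow> A $ m = 0)"

definition psd_hermitian :: "complex ^ 'a ^ 'a::finite \<Rightarrow> bool" where
  "psd_hermitian H \<longleftrightarrow>
     (\<forall>r s. H $ r $ s = cnj (H $ s $ r)) \<and>
     (\<forall>z. 0 \<le> Re (\<Sum>r\<in>UNIV. \<Sum>s\<in>UNIV. cnj (z $ r) * H $ r $ s * z $ s))"

definition line_matrix ::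
  "('n::finite, 'l::finite) network \<Rightarrow> ('n, 'l) state \<Rightarrow> 'l \<Rightarrow> complex ^ 2 ^ 2" where
  "line_matrix net x l =
     vector [vector [complex_of_real (x $ Mag (src net l)), Complex (x $ ReL l) (x $ ImL l)],
             vector [Complex (x $ ReL l) (- (x $ ImL l)), complex_of_real (x $ Mag (dst net l))]]"

definition soc_cone :: "('n::finite, 'l::finite) network \<Rightarrow> ('n, 'l) state set" where
  "soc_cone net = {x. \<forall>l. psd_hermitian (line_matrix net x l)}"

definition c_vec :: "('n::finite, 'l::finite) network \<Rightarrow> 'l \<Rightarrow> ('n, 'l) state" where
  "c_vec net l = (1 / sqrt 2) *\<^sub>R (coord (Mag (src net l)) + coord (Mag (dst net l)))"

definition D_mat :: "('n::finite, 'l::finite) network \<Rightarrow> 'l \<Rightarrow> real ^ ('n, 'l) var ^ 4" where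
  "D_mat net l =
     vector [(1 / sqrt 2) *\<^sub>R coord (Mag (src net l)), (1 / sqrt 2) *\<^sub>R coord (Mag (dst net l)),
             coord (ReL l), coord (ImL l)]"

definition T_mat ::
  "('n::finite, 'l::finite) network \<Rightarrow> 'l \<Rightarrow> real ^ ('n, 'l) var ^ ('n, 'l) var" where
  "T_mat net l =
     (\<chi> u v. c_vec net l $ u * c_vec net l $ v) - transpose (D_mat net l) ** D_mat net l"

lemma c_vec_inner:
  "c_vec net l \<bullet> x = (x $ Mag (src net l) + x $ Mag (dst net l)) / sqrt 2"
  by (simp add: c_vec_def inner_add_left inner_axis' add_divide_distrib)

lemma D_mat_mult:
  "D_mat net l *v x =
     vector [x $ Mag (src net l) / sqrt 2, x $ Mag (dst net l) / sqrt 2, x $ ReL l, x $ ImL l]"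
  by (simp add: vec_eq_iff forall_4 matrix_vector_mul_component D_mat_def vector_def inner_axis')

definition outer_lines :: "('n, 'l) network \<Rightarrow> 'n \<Rightarrow> 'n \<Rightarrow> 'l set" where
  "outer_lines net i j = {l. \<exists>k. k \<noteq> i \<and> joins net l j k}"

definition local_vars :: "('n, 'l) network \<Rightarrow> 'n \<Rightarrow> 'n \<Rightarrow> ('n, 'l) var set" where
  "local_vars net i j =
     {Mag j} \<union> {Mag k |k. k \<noteq> i \<and> (\<exists>l. joins net l j k)}
     \<union> ReL ` outer_lines net i j \<union> ImL ` outer_lines net i j"

definition local_lines :: "('n, 'l) network \<Rightarrow> 'l \<Rightarrow> 'n \<Rightarrow> 'n \<Rightarrow> 'l set" where
  "local_lines net l\<^sub>0 i j = insert l\<^sub>0 (outer_lines net i j)"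

definition good_meas ::
  "('n, 'l) network \<Rightarrow> ('n, 'l) meas set \<Rightarrow> 'n \<Rightarrow> 'n \<Rightarrow> ('n, 'l) meas set" where
  "good_meas net M i j = {m \<in> M. meas_vars net m \<subseteq> local_vars net i j}"

definition boundary_meas ::
  "('n, 'l) network \<Rightarrow> ('n, 'l) meas set \<Rightarrow> 'l \<Rightarrow> 'n \<Rightarrow> 'n \<Rightarrow> ('n, 'l) meas set" where
  "boundary_meas net M l\<^sub>0 i j =
     {m \<in> M. meas_vars net m \<inter> local_vars net i j \<noteq> {} \<and> {ReL l\<^sub>0, ImL l\<^sub>0} \<subseteq> meas_vars net m}"

(* Vectors indexed by a set S of coordinates are represented as vectors over the whole index type
   that vanish off S; submatrices and restrictions are zero-padded accordingly, which changes
   neither the products below nor the infinity norm. *)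
definition vecs_on :: "'a set \<Rightarrow> (real ^ 'a::finite) set" where
  "vecs_on S = {v. \<forall>a. a \<notin> S \<longrightarrow> v $ a = 0}"

definition sign_vecs :: "'a set \<Rightarrow> (real ^ 'a::finite) set" where
  "sign_vecs S = {v \<in> vecs_on S. \<forall>a\<in>S. v $ a \<in> {-1, 1}}"

definition restrict_vec :: "'a set \<Rightarrow> real ^ 'a::finite \<Rightarrow> real ^ 'a" where
  "restrict_vec S v = (\<chi> a. if a \<in> S then v $ a else 0)"

definition submat :: "real ^ 'b::finite ^ 'a::finite \<Rightarrow> 'a set \<Rightarrow> 'b set \<Rightarrow> real ^ 'b ^ 'a" where
  "submat A R C = (\<chi> a b. if a \<in> R \<and> b \<in> C then A $ a $ b else 0)"

definition feasible ::
  "('n::finite, 'l::finite) network \<Rightarrow> ('n, 'l) meas set \<Rightarrow> real ^ ('n, 'l) var ^ ('n, 'l) meas \<Rightarrow>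
   'l \<Rightarrow> 'n \<Rightarrow> 'n \<Rightarrow> real ^ ('n, 'l) meas \<Rightarrow> (real ^ ('n, 'l) meas) set" where
  "feasible net M A l\<^sub>0 i j \<xi> =
     {h \<in> vecs_on (good_meas net M i j).
        transpose (submat A (good_meas net M i j) (local_vars net i j)) *v h
        + transpose (submat A (boundary_meas net M l\<^sub>0 i j) (local_vars net i j)) *v \<xi> = 0}"

definition feasible_SOCP ::
  "('n::finite, 'l::finite) network \<Rightarrow> ('n, 'l) meas set \<Rightarrow> real ^ ('n, 'l) var ^ ('n, 'l) meas \<Rightarrow>
   'l \<Rightarrow> 'n \<Rightarrow> 'n \<Rightarrow> ('n, 'l) state \<Rightarrow> real ^ ('n, 'l) meas \<Rightarrow>
   ((real ^ ('n, 'l) meas) \<times> ('l \<Rightarrow> real)) set" where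
  "feasible_SOCP net M A l\<^sub>0 i j x \<xi> =
     {(h, \<omega>). h \<in> vecs_on (good_meas net M i j) \<and> (\<forall>l\<in>local_lines net l\<^sub>0 i j. 0 \<le> \<omega> l) \<and>
        transpose (submat A (good_meas net M i j) (local_vars net i j)) *v h
        + transpose (submat A (boundary_meas net M l\<^sub>0 i j) (local_vars net i j)) *v \<xi>
        + (\<Sum>l\<in>local_lines net l\<^sub>0 i j.
             \<omega> l *\<^sub>R restrict_vec (local_vars net i j) (T_mat net l *v x)) = 0}"

(* The minima are infima in the extended reals, so that an empty feasible set gives infinity;
   feasible_attains_min and feasible_SOCP_attains_min show that they are attained otherwise.
   The maxima are over the finite nonempty sets sign_vecs. *)
definition line_index ::
  "('n::finite, 'l::finite) network \<Rightarrow> ('n, 'l) meas set \<Rightarrow> real ^ ('n, 'l) var ^ ('n, 'l) meas \<Rightarrow>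
   'l \<Rightarrow> 'n \<Rightarrow> 'n \<Rightarrow> ereal" where
  "line_index net M A l\<^sub>0 i j =
     (MAX \<xi>\<in>sign_vecs (boundary_meas net M l\<^sub>0 i j).
        INF h\<in>feasible net M A l\<^sub>0 i j \<xi>. ereal (infnorm h))"

definition line_index_SOCP ::
  "('n::finite, 'l::finite) network \<Rightarrow> ('n, 'l) meas set \<Rightarrow> real ^ ('n, 'l) var ^ ('n, 'l) meas \<Rightarrow>
   'l \<Rightarrow> 'n \<Rightarrow> 'n \<Rightarrow> ('n, 'l) state \<Rightarrow> ereal" where
  "line_index_SOCP net M A l\<^sub>0 i j x =
     (MAX \<xi>\<in>sign_vecs (boundary_meas net M l\<^sub>0 i j).
        INF (h, \<omega>)\<in>feasible_SOCP net M A l\<^sub>0 i j x \<xi>. ereal (infnorm h))"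

lemma sign_vecs_finite_nonempty:
  "finite (sign_vecs S)" "sign_vecs S \<noteq> {}"
proof -
  have "sign_vecs S \<subseteq> vec_lambda ` (UNIV \<rightarrow>\<^sub>E {-1, 0, 1})"
  proof
    fix v assume "v \<in> sign_vecs S"
    then have "vec_nth v \<in> UNIV \<rightarrow>\<^sub>E {-1, 0, 1}"
      by (auto simp: sign_vecs_def vecs_on_def)
    then show "v \<in> vec_lambda ` (UNIV \<rightarrow>\<^sub>E {-1, 0, 1})"
      by (metis image_eqI vec_nth_inverse)
  qed
  then show "finite (sign_vecs S)"
    by (rule finite_subset) (intro finite_imageI finite_PiE, auto)
  have "(\<chi> a. if a \<in> S then 1 else 0) \<in> sign_vecs S"
    by (auto simp: sign_vecs_def vecs_on_def)
  then show "sign_vecs S \<noteq> {}" by blast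
qed

lemma closed_vecs_on: "closed (vecs_on S)"
proof -
  have "vecs_on S = (\<Inter>a\<in>- S. {v. v $ a = 0})"
    by (auto simp: vecs_on_def)
  then show ?thesis
    by (auto intro!: closed_INT closed_Collect_eq continuous_intros)
qed

lemma infnorm_attains_min:
  fixes S :: "('a::euclidean_space) set"
  assumes "closed S" "S \<noteq> {}"
  shows "\<exists>h\<in>S. \<forall>k\<in>S. infnorm h \<le> infnorm k"
proof -
  obtain s where s: "s \<in> S" using assms by blast
  define B where "B = S \<inter> {k. infnorm k \<le> infnorm s}"
  have "bounded {k :: 'a. infnorm k \<le> infnorm s}"
  proof (rule boundedI)
    fix k :: 'a assume "k \<in> {k. infnorm k \<le> infnorm s}"
    then show "norm k \<le> sqrt DIM('a) * infnorm s"
      using norm_le_infnorm[of k] by (smt (verit) mem_Collect_eq mult_left_mono real_sqrt_ge_0_iff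
          of_nat_0_le_iff)
  qed
  moreover have "closed {k :: 'a. infnorm k \<le> infnorm s}"
    by (intro closed_Collect_le continuous_intros)
  ultimately have "compact B"
    unfolding B_def using assms(1)
    by (metis bounded_Int closed_Int compact_eq_bounded_closed)
  moreover have "B \<noteq> {}" using s by (auto simp: B_def)
  moreover have "continuous_on B infnorm" by (intro continuous_intros)
  ultimately obtain h where h: "h \<in> B" "\<And>k. k \<in> B \<Longrightarrow> infnorm h \<le> infnorm k"
    using continuous_attains_inf[of B infnorm] by auto
  have "infnorm h \<le> infnorm k" if "k \<in> S" for k
  proof (cases "k \<in> B")
    case False
    then have "infnorm s < infnorm k" using that by (auto simp: B_def)
    then show ?thesis using h(1) by (auto simp: B_def)
  qed (use h in auto)
  then show ?thesis using h(1) by (auto simp: B_def)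
qed

lemma convex_cone_hull_image:
  assumes "finite L"
  shows "convex_cone hull (r ` L) = {\<Sum>l\<in>L. \<omega> l *\<^sub>R r l |\<omega>. \<forall>l\<in>L. 0 \<le> \<omega> l}" (is "_ = ?C")
proof (rule antisym)
  have "convex_cone ?C"
    unfolding convex_cone_iff
  proof (intro conjI ballI allI impI)
    show "0 \<in> ?C" by (rule CollectI, rule exI[of _ "\<lambda>_. 0"]) simp
  next
    fix u v assume "u \<in> ?C" "v \<in> ?C"
    then obtain \<omega> \<omega>' where "u = (\<Sum>l\<in>L. \<omega> l *\<^sub>R r l)" "v = (\<Sum>l\<in>L. \<omega>' l *\<^sub>R r l)"
      "\<forall>l\<in>L. 0 \<le> \<omega> l" "\<forall>l\<in>L. 0 \<le> \<omega>' l" by blast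
    then show "u + v \<in> ?C"
      by (intro CollectI exI[of _ "\<lambda>l. \<omega> l + \<omega>' l"])
        (simp add: scaleR_add_left sum.distrib)
  next
    fix u and c :: real assume "u \<in> ?C" "0 \<le> c"
    then obtain \<omega> where "u = (\<Sum>l\<in>L. \<omega> l *\<^sub>R r l)" "\<forall>l\<in>L. 0 \<le> \<omega> l" by blast
    with \<open>0 \<le> c\<close> show "c *\<^sub>R u \<in> ?C"
      by (intro CollectI exI[of _ "\<lambda>l. c * \<omega> l"]) (simp add: scaleR_sum_right)
  qed
  moreover have "r ` L \<subseteq> ?C"
  proof
    fix v assume "v \<in> r ` L"
    then obtain l where l: "l \<in> L" "v = r l" by blast
    have "(\<Sum>l'\<in>L. (if l' = l then 1 else 0) *\<^sub>R r l') = (\<Sum>l'\<in>L. if l' = l then r l' else 0)"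
      by (intro sum.cong) auto
    also have "\<dots> = v" using l assms by simp
    finally show "v \<in> ?C"
      by (intro CollectI exI[of _ "\<lambda>l'. if l' = l then 1 else 0"]) auto
  qed
  ultimately show "convex_cone hull (r ` L) \<subseteq> ?C"
    by (rule hull_minimal[rotated])
  have "(\<Sum>l\<in>L'. \<omega> l *\<^sub>R r l) \<in> convex_cone hull (r ` L)"
    if "\<forall>l\<in>L. 0 \<le> \<omega> l" "finite L'" "L' \<subseteq> L" for \<omega> L'
    using that(2,3)
  proof (induction L')
    case empty
    show ?case by (simp add: convex_cone_hull_contains_0)
  next
    case (insert l L')
    then show ?case
      using that(1) by (simp add: convex_cone_hull_add convex_cone_hull_mul hull_inc)
  qed
  then show "?C \<subseteq> convex_cone hull (r ` L)" using assms by blast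
qed

lemma feasible_attains_min:
  assumes "feasible net M A l\<^sub>0 i j \<xi> \<noteq> {}"
  shows "\<exists>h\<in>feasible net M A l\<^sub>0 i j \<xi>.
           (INF h\<in>feasible net M A l\<^sub>0 i j \<xi>. ereal (infnorm h)) = ereal (infnorm h)"
proof -
  have "closed (feasible net M A l\<^sub>0 i j \<xi>)"
    unfolding feasible_def Collect_conj_eq Collect_mem_eq
    by (intro closed_Int closed_vecs_on closed_Collect_eq continuous_intros)
  from infnorm_attains_min[OF this assms] show ?thesis
    by (auto intro!: bexI antisym INF_lower INF_greatest)
qed

lemma feasible_SOCP_attains_min:
  assumes "feasible_SOCP net M A l\<^sub>0 i j x \<xi> \<noteq> {}"
  shows "\<exists>(h, \<omega>)\<in>feasible_SOCP net M A l\<^sub>0 i j x \<xi>.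
           (INF (h, \<omega>)\<in>feasible_SOCP net M A l\<^sub>0 i j x \<xi>. ereal (infnorm h)) = ereal (infnorm h)"
proof -
  let ?F = "feasible_SOCP net M A l\<^sub>0 i j x \<xi>"
  let ?L = "local_lines net l\<^sub>0 i j"
  define r where "r l = restrict_vec (local_vars net i j) (T_mat net l *v x)" for l
  define p where "p h = transpose (submat A (good_meas net M i j) (local_vars net i j)) *v h
        + transpose (submat A (boundary_meas net M l\<^sub>0 i j) (local_vars net i j)) *v \<xi>" for h
  have "h \<in> fst ` ?F \<longleftrightarrow> h \<in> vecs_on (good_meas net M i j) \<and>
      - p h \<in> {\<Sum>l\<in>?L. \<omega> l *\<^sub>R r l |\<omega>. \<forall>l\<in>?L. 0 \<le> \<omega> l}" for h
  proof -
    have "h \<in> fst ` ?F \<longleftrightarrow> (\<exists>\<omega>. (h, \<omega>) \<in> ?F)"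
      by force
    also have "\<dots> \<longleftrightarrow> h \<in> vecs_on (good_meas net M i j) \<and>
        (\<exists>\<omega>. (\<forall>l\<in>?L. 0 \<le> \<omega> l) \<and> p h + (\<Sum>l\<in>?L. \<omega> l *\<^sub>R r l) = 0)"
      unfolding feasible_SOCP_def p_def r_def by simp
    also have "\<dots> \<longleftrightarrow> h \<in> vecs_on (good_meas net M i j) \<and>
        (\<exists>\<omega>. (\<forall>l\<in>?L. 0 \<le> \<omega> l) \<and> - p h = (\<Sum>l\<in>?L. \<omega> l *\<^sub>R r l))"
      by (simp only: neg_eq_iff_add_eq_0)
    finally show ?thesis by auto
  qed
  then have "fst ` ?F = vecs_on (good_meas net M i j) \<inter> (\<lambda>h. - p h) -` (convex_cone hull (r ` ?L))"
    unfolding convex_cone_hull_image[OF finite] by blast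
  moreover have "closed ((\<lambda>h. - p h) -` (convex_cone hull (r ` ?L)))"
    unfolding p_def
    by (intro closed_vimage closed_convex_cone_hull finite_imageI finite continuous_intros)
  ultimately have "closed (fst ` ?F)"
    by (simp add: closed_Int closed_vecs_on)
  moreover have "fst ` ?F \<noteq> {}" using assms by simp
  ultimately obtain h where "h \<in> fst ` ?F" and h: "\<forall>k\<in>fst ` ?F. infnorm h \<le> infnorm k"
    using infnorm_attains_min by blast
  then obtain \<omega> where F: "(h, \<omega>) \<in> ?F" by force
  have "(INF (h, \<omega>)\<in>?F. ereal (infnorm h)) = ereal (infnorm h)"
  proof (rule antisym)
    show "(INF (h, \<omega>)\<in>?F. ereal (infnorm h)) \<le> ereal (infnorm h)"
      using INF_lower[OF F, of "\<lambda>(h, \<omega>). ereal (infnorm h)"] by simp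
    show "ereal (infnorm h) \<le> (INF (h, \<omega>)\<in>?F. ereal (infnorm h))"
      using h by (force intro!: INF_greatest)
  qed
  with F show ?thesis by blast
qed

end

theory Submission
  imports Defs
begin

text \<open>The SOCP problem relaxes the linear one: \<open>\<omega>\<close> = 0 is an admissible
  choice that gives back the original equation, so the multipliers can only enlarge the set of
  admissible \<open>h\<close>, while the objective stays the same. Hence the SOCP minimum is at most
  the linear one for each sign vector \<xi> (\<open>INF_feasible_SOCP_le\<close>), and the maximum
  over the same finite set of \<xi> keeps this order.\<close>

lemma feasible_SOCP_zero:
  assumes "h \<in> feasible net M A l i j \<xi>"
  shows "(h, \<lambda>_. 0) \<in> feasible_SOCP net M A l i j x \<xi>"
  using assms by (simp add: feasible_def feasible_SOCP_def)

text \<open>Each \<open>h\<close> on the right is matched by the pair (\<open>h\<close>, 0) of equal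
  norm on the left. If \<open>feasible\<close> is empty, the right side is \<infinity> and no match
  is required.\<close>

lemma INF_feasible_SOCP_le:
  "(INF (h, \<omega>)\<in>feasible_SOCP net M A l i j x \<xi>. ereal (infnorm h))
     \<le> (INF h\<in>feasible net M A l i j \<xi>. ereal (infnorm h))"
  by (rule INF_mono, rule bexI[OF _ feasible_SOCP_zero]) auto

theorem proposition2:
  fixes net :: "('n::finite, 'l::finite) network"
    and M :: "('n, 'l) meas set"
    and A :: "real ^ ('n, 'l) var ^ ('n, 'l) meas"
    and x :: "real ^ ('n, 'l) var"
    and l :: 'l and i j :: 'n
  assumes "simple_network net"
    and "sensing_matrix net M A"
    and "joins net l i j"
    and "x \<in> soc_cone net"
  shows "line_index_SOCP net M A l i j x \<le> line_index net M A l i j"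
  unfolding line_index_SOCP_def line_index_def
proof (rule Max.boundedI)
  let ?S = "sign_vecs (boundary_meas net M l i j)"
  let ?f = "\<lambda>\<xi>. INF (h, \<omega>)\<in>feasible_SOCP net M A l i j x \<xi>. ereal (infnorm h)"
  let ?g = "\<lambda>\<xi>. INF h\<in>feasible net M A l i j \<xi>. ereal (infnorm h)"
  show "finite (?f ` ?S)" "?f ` ?S \<noteq> {}"
    by (simp_all add: sign_vecs_finite_nonempty)
  fix y assume "y \<in> ?f ` ?S"
  then obtain \<xi> where \<xi>: "\<xi> \<in> ?S" and y: "y = ?f \<xi>" by (rule imageE)
  \<comment> \<open>Both problems are compared at the same \<xi>, which need not maximize either
    side.\<close>
  have "?f \<xi> \<le> ?g \<xi>" by (rule INF_feasible_SOCP_le)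
  also have "\<dots> \<le> Max (?g ` ?S)"
    using \<xi> by (intro Max_ge finite_imageI sign_vecs_finite_nonempty imageI)
  finally show "y \<le> Max (?g ` ?S)" unfolding y .
qed

end
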